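(* Let $f,\mu,u_0$ satisfy assumptions (A1)–(A4) listed in the context, and suppose there exists $\overline h\in\mathbb{R}$ such that $f(\overline h,\mu(D_{\overline h}(0)))\le 0\le f(\overline h,\mu(E_{\overline h}(0)))$. Let $u$ be the unique continuous viscosity solution of the Cauchy problem in the context satisfying the growth condition stated there. Assume in addition that $$\limsup_{s\to0+}\frac{f(\overline h,\mu(D_{\overline h}(-s)))}{s}<0,$$ and that for any sufficiently small $b>0$ there exists $a>0$ such that $$f(h,\mu(E_h(s)))-f(h,\mu(E_h(0)))\ge a s\quad\text{for all }\overline h\le h\le\overline h+b,\ 0\le s\le 1/b.$$ Let $g:[0,\infty)\to[0,\infty)$ be a modulus of continuity of $u_0$, i.e. $g$ is continuous, strictly increasing, $g(0)=0$ and $|u_0(x)-u_0(y)|\le g(|x-y|)$ for all $x,y\in\mathbb{R}^n$. Then for any compact set $K\subset\mathbb{R}^n$ there exist $C_K>0$ and $\lambda>0$ such that $$|u(x,t)-\overline h|\le g(C_Ke^{-\lambda t})\quad\text{for all }x\in K\text{ and all sufficiently large }t\ge0.$$ In particular, if $u_0$ is Hölder continuous with exponent $\alpha\in(0,1]$ and Hölder constant $L>0$, then for any compact set $K\subset\mathbb{R}^n$, with $\lambda>0$ denoting a constant for which the estimate $|u(x,t)-\overline h|\le g(Ce^{-\lambda t})$ with $g(r)=Lr^\alpha$ holds for some $C>0$, all $x\in K$ and all sufficiently large $t\ge0$, there exists $C_K>0$ such that $|u(x,t)-\overline h|\le C_Ke^{-\alpha\lambda t}$ for all $x\in K$ and all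 sufficiently large $t>0$.
   Context: Setting. $\mathcal{B}$ is the family of Lebesgue measurable subsets of $\mathbb{R}^n$; $f:\mathbb{R}\times[0,\infty)\to\mathbb{R}$, $\mu:\mathcal{B}\to[0,\infty)$, $u_0:\mathbb{R}^n\to\mathbb{R}$. (A1) $f$ is bounded and continuous, and there is a modulus of continuity $\omega_f$ with $|f(r,q_1)-f(r,q_2)|\le\omega_f(|q_1-q_2|)$ for all $r\in\mathbb{R}$, $q_1,q_2\ge0$. (A2) $f(r_1,q)\le f(r_2,q)$ for $r_1<r_2$, $q\ge0$; and $f(r,q_1)<f(r,q_2)$ for $r\in\mathbb{R}$, $0\le q_1<q_2$. (A3) $\mu(A)=\int_A\Theta(x)\,dx$ for $A\in\mathcal{B}$, where $\Theta\in L^1(\mathbb{R}^n)$, $\Theta>0$ in $\mathbb{R}^n$. (A4) $u_0$ is uniformly continuous and $\lim_{R\to\infty}\inf\{u_0(y):|y|\ge R\}>u_0(x)$ for every $x\in\mathbb{R}^n$. Cauchy problem: $u_t(x,t)+|\nabla u(x,t)|f(u(x,t),\mu(\{u(\cdot,t)<u(x,t)\}))=0$ in $\mathbb{R}^n\times(0,\infty)$, $u(\cdot,0)=u_0$. Growth condition: for any $T>0$ there is $M_T>0$ with $|u(x,t)|\le M_T(|x|+1)$ on $\mathbb{R}^n\times[0,T]$. Viscosity solution: a locally bounded upper semicontinuous $u$ is a subsolution if whenever $\varphi\in C^1$ and $u-\varphi$ has a local maximum at $(x_0,t_0)$, $t_0>0$, then $\varphi_t+|\nabla\varphi|f(u,\mu(\{u(\cdot,t_0)<u(x_0,t_0)\}))\le0$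 at $(x_0,t_0)$; a locally bounded lower semicontinuous $u$ is a supersolution if whenever $u-\varphi$ has a local minimum at $(x_0,t_0)$, then $\varphi_t+|\nabla\varphi|f(u,\mu(\{u(\cdot,t_0)\le u(x_0,t_0)\}))\ge0$ at $(x_0,t_0)$; a continuous function that is both is a solution. Under (A1)–(A4) and existence of $\overline h$, a unique continuous solution $u\in C(\mathbb{R}^n\times[0,\infty))$ with the growth condition exists. Parallel sets. For $h\in\mathbb{R}$: $D_h(0)=\{u_0<h\}$, $E_h(0)=\{u_0\le h\}$, and for $s\in\mathbb{R}$, $D_h(s)=\{x:\mathrm{sd}(x,D_h(0))<s\}$, $E_h(s)=\{x:\mathrm{sd}(x,E_h(0))\le s\}$, with $\mathrm{sd}(x,A)=\mathrm{dist}(x,A)-\mathrm{dist}(x,\mathbb{R}^n\setminus A)$ and $\mathrm{dist}(x,\emptyset)=+\infty$. *)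

theory Defs
  imports "HOL-Analysis.Analysis"
begin

definition modulus :: "(real \<Rightarrow> real) \<Rightarrow> bool" where
  "modulus \<omega> \<longleftrightarrow>
     continuous_on {0..} \<omega> \<and> strict_mono_on {0..} \<omega> \<and> \<omega> 0 = 0 \<and> (\<forall>r\<ge>0. 0 \<le> \<omega> r)"

text \<open>Space and time arguments of the unknown are curried; values at negative times are junk
  and are never inspected.\<close>

abbreviation spacetime :: "('a::euclidean_space \<times> real) set" where
  "spacetime \<equiv> UNIV \<times> {0<..}"

definition locally_bounded_on :: "'b::topological_space set \<Rightarrow> ('b \<Rightarrow> real) \<Rightarrow> bool" where
  "locally_bounded_on S v \<longleftrightarrow> (\<forall>p\<in>S. \<exists>U. open U \<and> p \<in> U \<and> bounded (v ` (U \<inter> S)))"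

definition usc_on :: "'b::topological_space set \<Rightarrow> ('b \<Rightarrow> real) \<Rightarrow> bool" where
  "usc_on S v \<longleftrightarrow> (\<forall>p\<in>S. \<forall>c>v p. \<forall>\<^sub>F q in at p within S. v q < c)"

definition lsc_on :: "'b::topological_space set \<Rightarrow> ('b \<Rightarrow> real) \<Rightarrow> bool" where
  "lsc_on S v \<longleftrightarrow> (\<forall>p\<in>S. \<forall>c<v p. \<forall>\<^sub>F q in at p within S. c < v q)"

text \<open>\<open>\<phi>\<close> is continuously differentiable with spatial gradient \<open>\<phi>x\<close> and time derivative \<open>\<phi>t\<close>.\<close>

definition C1_test_function ::
  "('a::euclidean_space \<times> real \<Rightarrow> real) \<Rightarrow> ('a \<times> real \<Rightarrow> 'a) \<Rightarrow> ('a \<times> real \<Rightarrow> real) \<Rightarrow> bool" where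
  "C1_test_function \<phi> \<phi>x \<phi>t \<longleftrightarrow>
     (\<forall>p\<in>spacetime. (\<phi> has_derivative (\<lambda>(y, s). \<phi>x p \<bullet> y + \<phi>t p * s)) (at p)) \<and>
     continuous_on spacetime \<phi>x \<and> continuous_on spacetime \<phi>t"

definition viscosity_subsolution ::
  "(real \<Rightarrow> real \<Rightarrow> real) \<Rightarrow> ('a::euclidean_space set \<Rightarrow> real) \<Rightarrow> ('a \<Rightarrow> real \<Rightarrow> real) \<Rightarrow> bool" where
  "viscosity_subsolution f \<mu> u \<longleftrightarrow>
     locally_bounded_on spacetime (\<lambda>(x, t). u x t) \<and>
     usc_on spacetime (\<lambda>(x, t). u x t) \<and>
     (\<forall>\<phi> \<phi>x \<phi>t x0 t0.
        0 < t0 \<longrightarrow> C1_test_function \<phi> \<phi>x \<phi>t \<longrightarrow>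
        (\<forall>\<^sub>F (x, t) in nhds (x0, t0). u x t - \<phi> (x, t) \<le> u x0 t0 - \<phi> (x0, t0)) \<longrightarrow>
        \<phi>t (x0, t0) + norm (\<phi>x (x0, t0)) * f (u x0 t0) (\<mu> {y. u y t0 < u x0 t0}) \<le> 0)"

definition viscosity_supersolution ::
  "(real \<Rightarrow> real \<Rightarrow> real) \<Rightarrow> ('a::euclidean_space set \<Rightarrow> real) \<Rightarrow> ('a \<Rightarrow> real \<Rightarrow> real) \<Rightarrow> bool" where
  "viscosity_supersolution f \<mu> u \<longleftrightarrow>
     locally_bounded_on spacetime (\<lambda>(x, t). u x t) \<and>
     lsc_on spacetime (\<lambda>(x, t). u x t) \<and>
     (\<forall>\<phi> \<phi>x \<phi>t x0 t0.
        0 < t0 \<longrightarrow> C1_test_function \<phi> \<phi>x \<phi>t \<longrightarrow>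
        (\<forall>\<^sub>F (x, t) in nhds (x0, t0). u x0 t0 - \<phi> (x0, t0) \<le> u x t - \<phi> (x, t)) \<longrightarrow>
        \<phi>t (x0, t0) + norm (\<phi>x (x0, t0)) * f (u x0 t0) (\<mu> {y. u y t0 \<le> u x0 t0}) \<ge> 0)"

definition cauchy_viscosity_solution ::
  "(real \<Rightarrow> real \<Rightarrow> real) \<Rightarrow> ('a::euclidean_space set \<Rightarrow> real) \<Rightarrow> ('a \<Rightarrow> real) \<Rightarrow> ('a \<Rightarrow> real \<Rightarrow> real) \<Rightarrow> bool" where
  "cauchy_viscosity_solution f \<mu> u0 u \<longleftrightarrow>
     continuous_on (UNIV \<times> {0..}) (\<lambda>(x, t). u x t) \<and>
     viscosity_subsolution f \<mu> u \<and> viscosity_supersolution f \<mu> u \<and>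
     (\<forall>x. u x 0 = u0 x)"

definition linear_growth :: "('a::euclidean_space \<Rightarrow> real \<Rightarrow> real) \<Rightarrow> bool" where
  "linear_growth u \<longleftrightarrow>
     (\<forall>T>0. \<exists>M>0. \<forall>x. \<forall>t\<in>{0..T}. \<bar>u x t\<bar> \<le> M * (norm x + 1))"

text \<open>Unlike \<^const>\<open>infdist\<close>, the distance to the empty set is \<open>\<infinity>\<close>. In the signed distance the
  undetermined form \<open>\<infinity> - \<infinity>\<close> does not occur, since a set and its complement are not both empty.\<close>

definition set_edist :: "'a::euclidean_space \<Rightarrow> 'a set \<Rightarrow> ereal" where
  "set_edist x A = (INF y\<in>A. ereal (dist x y))"

definition signed_dist :: "'a::euclidean_space \<Rightarrow> 'a set \<Rightarrow> ereal" where
  "signed_dist x A = set_edist x A - set_edist x (- A)"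

definition D_par :: "('a::euclidean_space \<Rightarrow> real) \<Rightarrow> real \<Rightarrow> real \<Rightarrow> 'a set" where
  "D_par u0 h s = {x. signed_dist x {y. u0 y < h} < ereal s}"

definition E_par :: "('a::euclidean_space \<Rightarrow> real) \<Rightarrow> real \<Rightarrow> real \<Rightarrow> 'a set" where
  "E_par u0 h s = {x. signed_dist x {y. u0 y \<le> h} \<le> ereal s}"

lemma set_edist_nonneg: "0 \<le> set_edist x A"
  unfolding set_edist_def by (auto intro!: INF_greatest)

lemma set_edist_mem: "x \<in> A \<Longrightarrow> set_edist x A = 0"
  using set_edist_nonneg[of x A] INF_lower[of x A "\<lambda>y. ereal (dist x y)"]
  unfolding set_edist_def by (simp add: zero_ereal_def)

lemma set_edist_pos: 
  assumes "closed A" "x \<notin> A" 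
  shows "0 < set_edist x A"
proof -
  have "open (- A)" using assms by auto
  then obtain e where e: "e > 0" "ball x e \<subseteq> - A"
    using assms open_contains_ball by blast
  have "ereal e \<le> set_edist x A"
    unfolding set_edist_def using e by (intro INF_greatest) (auto simp: subset_eq not_less[symmetric])
  then show ?thesis using e by (metis ereal_less(2) less_le_trans)
qed

text \<open>For continuous data the sets at \<open>s = 0\<close> are the sublevel sets themselves.\<close>

lemma D_par_0:
  assumes "continuous_on UNIV u0"
  shows "D_par u0 h 0 = {x. u0 x < h}"
proof -
  let ?A = "{x. u0 x < h}"
  have "open ?A" using assms by (intro open_Collect_less) auto
  then have "signed_dist x ?A < 0 \<longleftrightarrow> x \<in> ?A" for x
  proof (cases "x \<in> ?A")
    case True
    with \<open>open ?A\<close> have "0 < set_edist x (- ?A)" by (intro set_edist_pos) auto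
    with True show ?thesis by (simp add: signed_dist_def set_edist_mem ereal_uminus_less_reorder)
  next
    case False
    then have "set_edist x (- ?A) = 0" by (intro set_edist_mem) auto
    with False show ?thesis using set_edist_nonneg[of x ?A] by (simp add: signed_dist_def not_less)
  qed
  then show ?thesis unfolding D_par_def zero_ereal_def[symmetric] by blast
qed

lemma E_par_0:
  assumes "continuous_on UNIV u0"
  shows "E_par u0 h 0 = {x. u0 x \<le> h}"
proof -
  let ?A = "{x. u0 x \<le> h}"
  have "closed ?A" using assms by (intro closed_Collect_le) auto
  then have "signed_dist x ?A \<le> 0 \<longleftrightarrow> x \<in> ?A" for x
  proof (cases "x \<in> ?A")
    case True
    then show ?thesis using set_edist_nonneg[of x "- ?A"] by (simp add: signed_dist_def set_edist_mem)
  next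
    case False
    then have "set_edist x (- ?A) = 0" by (intro set_edist_mem) auto
    with False \<open>closed ?A\<close> show ?thesis using set_edist_pos[of ?A x] by (simp add: signed_dist_def not_le)
  qed
  then show ?thesis unfolding E_par_def zero_ereal_def[symmetric] by blast
qed

end

theory Submission
  imports Defs
begin

text \<open>For a compact set \<open>F\<close> and a radius \<open>R(t) = \<rho> e\<^sup>\<kappa>\<^sup>t\<close>, the solution is compared with
  \<open>h + \<eta>(1 + t) + A(|x - y| - R(t))\<^sub>+\<^sup>2\<close>, the difference being maximised over \<open>x\<close>, \<open>t\<close> and also over
  the centre \<open>y \<in> F\<close>. At a positive maximum \<open>(x, t, y)\<close> with nonzero gradient, every point within \<open>R(t)\<close>
  of \<open>F\<close> has a value below \<open>u(x, t)\<close>, so the nonlocal term is at least its value on that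
  neighbourhood; hence a set where \<open>u \<le> h\<close> spreads at least as fast as the parallel sets of \<open>F\<close>.
  Since \<open>u\<^sub>0 \<le> hbar + g(\<rho>)\<close> within \<open>\<rho>\<close> of \<open>F = {u\<^sub>0 \<le> hbar}\<close>, and the speed of the parallel set at
  distance \<open>s\<close> is at least \<open>a s\<close>, the choice \<open>\<rho> = C e\<^sup>-\<^sup>a\<^sup>t\<close> gives a radius \<open>C\<close> at time \<open>t\<close>, which covers \<open>K\<close>.
  The lower bound is the same argument for \<open>- u\<close> and \<open>F = {u\<^sub>0 \<ge> hbar}\<close>. This set is not compact, but by
  finite speed of propagation \<open>u \<ge> hbar\<close> outside a large ball, so only a bounded part of it matters.\<close>

section \<open>Comparison with a radial barrier\<close>

text \<open>The square removes the kink of the positive part at 0. This is why the barrier penalises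
  \<open>(|x - y| - R(t))\<close> through its squared positive part: the result is continuously
  differentiable across the moving sphere.\<close>

lemma has_real_derivative_max_0_squared:
  "((\<lambda>s::real. (max 0 s)\<^sup>2) has_real_derivative 2 * max 0 s) (at s)"
proof -
  consider "s < 0" | "s = 0" | "s > 0" by linarith
  then show ?thesis
  proof cases
    case 1
    have "((\<lambda>s. 0) has_real_derivative 0) (at s)" by simp
    then have "((\<lambda>s::real. (max 0 s)\<^sup>2) has_real_derivative 0) (at s)"
      by (rule has_field_derivative_transform_within_open[where S = "{..<0}"]) (use 1 in auto)
    with 1 show ?thesis by simp
  next
    case 2
    have "((\<lambda>h::real. (max 0 h)\<^sup>2 / h) \<longlongrightarrow> 0) (at 0)"
    proof (rule Lim_null_comparison)
      show "\<forall>\<^sub>F h in at 0. norm ((max 0 h)\<^sup>2 / h) \<le> \<bar>h::real\<bar>"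
        by (intro always_eventually) (auto simp: max_def power2_eq_square)
      show "(abs \<longlongrightarrow> (0::real)) (at 0)" using tendsto_rabs[OF tendsto_ident_at, of "0::real"] by simp
    qed
    then show ?thesis using 2 by (simp add: DERIV_def)
  next
    case 3
    have "((\<lambda>s. s\<^sup>2) has_real_derivative 2 * s) (at s)" by (auto intro!: derivative_eq_intros)
    then have "((\<lambda>s::real. (max 0 s)\<^sup>2) has_real_derivative 2 * s) (at s)"
      by (rule has_field_derivative_transform_within_open[where S = "{0<..}"]) (use 3 in auto)
    with 3 show ?thesis by simp
  qed
qed

text \<open>Inside the ball the barrier vanishes on an open set. On and outside the sphere
  \<open>x\<close> differs from \<open>y\<close>, because the radius is positive, so the norm is
  differentiable there. The \<open>max\<close> in the denominator equals \<open>norm (x - y)\<close>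
  wherever the numerator is nonzero, and it keeps the gradient formula free of a singularity at
  \<open>x = y\<close>.\<close>

lemma has_derivative_ball_barrier:
  fixes x y :: "'a::euclidean_space"
  assumes "0 < \<rho>"
  shows "((\<lambda>(x, t). (max 0 (norm (x - y) - \<rho> * exp (\<kappa> * t)))\<^sup>2) has_derivative
    (\<lambda>(z, s). (2 * max 0 (norm (x - y) - \<rho> * exp (\<kappa> * t)) / max (norm (x - y)) (\<rho> * exp (\<kappa> * t))) *\<^sub>R (x - y) \<bullet> z
      - 2 * max 0 (norm (x - y) - \<rho> * exp (\<kappa> * t)) * (\<kappa> * (\<rho> * exp (\<kappa> * t))) * s)) (at (x, t))"
proof (cases "norm (x - y) < \<rho> * exp (\<kappa> * t)")
  case True
  have "((\<lambda>_. 0) has_derivative (\<lambda>_. 0)) (at (x, t))" by simp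
  then have "((\<lambda>(x, t). (max 0 (norm (x - y) - \<rho> * exp (\<kappa> * t)))\<^sup>2) has_derivative (\<lambda>_. 0)) (at (x, t))"
  proof (rule has_derivative_transform_within_open)
    show "open {p. norm (fst p - y) < \<rho> * exp (\<kappa> * snd p)}"
      by (intro open_Collect_less continuous_intros)
  qed (use True in auto)
  moreover have "max 0 (norm (x - y) - \<rho> * exp (\<kappa> * t)) = 0" using True by simp
  ultimately show ?thesis by (simp add: case_prod_unfold)
next
  case False
  have R: "0 < \<rho> * exp (\<kappa> * t)" using assms by simp
  then have ne: "x - y \<noteq> 0" using False by auto
  have mx: "max (norm (x - y)) (\<rho> * exp (\<kappa> * t)) = norm (x - y)" using False by simp
  have "((\<lambda>p. fst p - y) has_derivative fst) (at (x, t))" for t :: real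
    by (auto intro!: derivative_eq_intros)
  from has_derivative_compose[OF this has_derivative_norm] ne
  have n: "((\<lambda>p. norm (fst p - y)) has_derivative (\<lambda>q. fst q \<bullet> sgn (x - y))) (at (x, t))"
    by simp
  have e: "((\<lambda>p. \<rho> * exp (\<kappa> * snd p)) has_derivative (\<lambda>q. \<rho> * (exp (\<kappa> * t) * (\<kappa> * snd q)))) (at (x, t))"
    by (auto intro!: derivative_eq_intros)
  have d: "((\<lambda>p. norm (fst p - y) - \<rho> * exp (\<kappa> * snd p)) has_derivative
     (\<lambda>q. sgn (x - y) \<bullet> fst q - \<rho> * (exp (\<kappa> * t) * (\<kappa> * snd q)))) (at (x, t))"
    using has_derivative_diff[OF n e] by (simp add: inner_commute)
  have "((\<lambda>p. (max 0 (norm (fst p - y) - \<rho> * exp (\<kappa> * snd p)))\<^sup>2) has_derivative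
     (\<lambda>q. 2 * max 0 (norm (x - y) - \<rho> * exp (\<kappa> * t)) *
       (sgn (x - y) \<bullet> fst q - \<rho> * (exp (\<kappa> * t) * (\<kappa> * snd q))))) (at (x, t))"
    using DERIV_compose_FDERIV[OF has_real_derivative_max_0_squared d]
    by (simp add: mult.commute)
  moreover have "(\<lambda>q. 2 * max 0 (norm (x - y) - \<rho> * exp (\<kappa> * t)) *
       (sgn (x - y) \<bullet> fst q - \<rho> * (exp (\<kappa> * t) * (\<kappa> * snd q)))) =
    (\<lambda>(z, s). (2 * max 0 (norm (x - y) - \<rho> * exp (\<kappa> * t)) / max (norm (x - y)) (\<rho> * exp (\<kappa> * t))) *\<^sub>R (x - y) \<bullet> z
      - 2 * max 0 (norm (x - y) - \<rho> * exp (\<kappa> * t)) * (\<kappa> * (\<rho> * exp (\<kappa> * t))) * s)"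
    unfolding mx by (auto simp: fun_eq_iff sgn_div_norm divide_inverse right_diff_distrib mult_ac)
  ultimately show ?thesis by (simp add: case_prod_unfold)
qed

text \<open>This is the test function of the comparison, for one fixed centre \<open>y\<close>. The
  term with \<open>t - T\<close> penalises only times after \<open>T\<close>, so the value at the
  target time is unaffected.\<close>

lemma C1_test_function_ball_barrier:
  fixes y :: "'a::euclidean_space"
  assumes "0 < \<rho>"
  shows "C1_test_function
    (\<lambda>(x, t). h + \<eta> * (1 + t) + A * ((max 0 (norm (x - y) - \<rho> * exp (\<kappa> * t)))\<^sup>2 + (max 0 (t - T))\<^sup>2))
    (\<lambda>(x, t). (2 * A * max 0 (norm (x - y) - \<rho> * exp (\<kappa> * t)) / max (norm (x - y)) (\<rho> * exp (\<kappa> * t))) *\<^sub>R (x - y))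
    (\<lambda>(x, t). \<eta> - 2 * A * max 0 (norm (x - y) - \<rho> * exp (\<kappa> * t)) * (\<kappa> * (\<rho> * exp (\<kappa> * t))) + 2 * A * max 0 (t - T))"
  unfolding C1_test_function_def
proof (intro conjI ballI)
  fix p :: "'a \<times> real"
  obtain x t where p: "p = (x, t)" by fastforce
  have "((\<lambda>p. snd p - T) has_derivative snd) (at (x, t))" for x :: 'a and t
    by (auto intro!: derivative_eq_intros)
  from DERIV_compose_FDERIV[OF has_real_derivative_max_0_squared this]
  have time: "((\<lambda>p. (max 0 (snd p - T))\<^sup>2) has_derivative (\<lambda>q. snd q * (2 * max 0 (t - T)))) (at (x, t))" by simp
  have "((\<lambda>p. h + \<eta> * (1 + snd p)) has_derivative (\<lambda>q. \<eta> * snd q)) (at (x, t))"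
    by (auto intro!: derivative_eq_intros)
  from has_derivative_add[OF this has_derivative_mult_right[OF has_derivative_add[OF has_derivative_ball_barrier[OF assms] time]]]
  have "((\<lambda>p. h + \<eta> * (1 + snd p) + A * ((case p of (x, t) \<Rightarrow> (max 0 (norm (x - y) - \<rho> * exp (\<kappa> * t)))\<^sup>2) + (max 0 (snd p - T))\<^sup>2))
     has_derivative (\<lambda>q. \<eta> * snd q + A * ((case q of (z, s) \<Rightarrow> (2 * max 0 (norm (x - y) - \<rho> * exp (\<kappa> * t)) / max (norm (x - y)) (\<rho> * exp (\<kappa> * t))) *\<^sub>R (x - y) \<bullet> z
      - 2 * max 0 (norm (x - y) - \<rho> * exp (\<kappa> * t)) * (\<kappa> * (\<rho> * exp (\<kappa> * t))) * s) + snd q * (2 * max 0 (t - T))))) (at (x, t))"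
    .
  then show "((\<lambda>(x, t). h + \<eta> * (1 + t) + A * ((max 0 (norm (x - y) - \<rho> * exp (\<kappa> * t)))\<^sup>2 + (max 0 (t - T))\<^sup>2)) has_derivative
          (\<lambda>(z, s). (case p of (x, t) \<Rightarrow> (2 * A * max 0 (norm (x - y) - \<rho> * exp (\<kappa> * t)) / max (norm (x - y)) (\<rho> * exp (\<kappa> * t))) *\<^sub>R (x - y)) \<bullet> z
            + (case p of (x, t) \<Rightarrow> \<eta> - 2 * A * max 0 (norm (x - y) - \<rho> * exp (\<kappa> * t)) * (\<kappa> * (\<rho> * exp (\<kappa> * t))) + 2 * A * max 0 (t - T)) * s)) (at p)"
    unfolding p case_prod_unfold fst_conv snd_conv
    by (rule has_derivative_eq_rhs) (auto simp: fun_eq_iff algebra_simps)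
next
  \<comment> \<open>The denominator stays positive, which is what makes the gradient continuous even
    at the centre.\<close>
  have "max (norm (fst p - y)) (\<rho> * exp (\<kappa> * snd p)) \<noteq> 0" for p
    using assms by (smt (verit) exp_gt_zero mult_pos_pos)
  then show "continuous_on spacetime (\<lambda>(x, t). (2 * A * max 0 (norm (x - y) - \<rho> * exp (\<kappa> * t)) / max (norm (x - y)) (\<rho> * exp (\<kappa> * t))) *\<^sub>R (x - y))"
    unfolding case_prod_unfold by (intro continuous_intros) auto
  show "continuous_on spacetime (\<lambda>(x, t). \<eta> - 2 * A * max 0 (norm (x - y) - \<rho> * exp (\<kappa> * t)) * (\<kappa> * (\<rho> * exp (\<kappa> * t))) + 2 * A * max 0 (t - T))"
    unfolding case_prod_unfold by (intro continuous_intros)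
qed


text \<open>The function \<open>v\<close> stands for \<open>u\<close> or for \<open>- u\<close>, so
  one proof serves both bounds. In \<open>visc\<close> the number \<open>q\<close> replaces the
  value of the nonlocal term. At a positive maximum the derivative inequality forces
  \<open>q\<close> strictly below the expansion speed of the radius, whereas maximality over all
  centres puts the whole neighbourhood of \<open>F\<close> strictly below the current level, and
  then \<open>visc\<close> forces \<open>q\<close> to be at least that speed.\<close>

lemma ball_barrier_comparison:
  fixes v :: "'a::euclidean_space \<Rightarrow> real \<Rightarrow> real"
  assumes F: "compact F" and \<rho>: "0 < \<rho>" and T: "0 \<le> T"
    and cont: "continuous_on (UNIV \<times> {0..}) (\<lambda>(x, t). v x t)"
    and M: "0 \<le> M"
    and growth: "\<And>x t. 0 \<le> t \<Longrightarrow> t \<le> T + 1 \<Longrightarrow> v x t \<le> M * (norm x + 1)"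
    and init: "\<And>x y. y \<in> F \<Longrightarrow> norm (x - y) \<le> \<rho> \<Longrightarrow> v x 0 \<le> h"
    and visc: "\<And>\<phi> \<phi>x \<phi>t x0 t0. 0 < t0 \<Longrightarrow> t0 < T + 1 \<Longrightarrow> C1_test_function \<phi> \<phi>x \<phi>t \<Longrightarrow>
        (\<forall>\<^sub>F (x, t) in nhds (x0, t0). v x t - \<phi> (x, t) \<le> v x0 t0 - \<phi> (x0, t0)) \<Longrightarrow> h < v x0 t0 \<Longrightarrow>
        \<exists>q. \<phi>t (x0, t0) + norm (\<phi>x (x0, t0)) * q \<le> 0 \<and>
          ((\<forall>z. \<forall>y\<in>F. norm (z - y) \<le> \<rho> * exp (\<kappa> * t0) \<longrightarrow> v z t0 < v x0 t0) \<longrightarrow>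
           \<kappa> * (\<rho> * exp (\<kappa> * t0)) \<le> q)"
    and x1: "y1 \<in> F" "norm (x1 - y1) \<le> \<rho> * exp (\<kappa> * T)"
  shows "v x1 T \<le> h"
proof -
  \<comment> \<open>The slack \<open>\<eta> * (1 + t)\<close> makes the barrier a strict one; \<eta>
    is sent to 0 at the end.\<close>
  have "v x1 T \<le> h + \<eta> * (1 + T)" if \<eta>: "0 < \<eta>" for \<eta>
  proof (rule ccontr)
    assume neg: "\<not> v x1 T \<le> h + \<eta> * (1 + T)"
    define G where "G x t y = (max 0 (norm (x - y) - \<rho> * exp (\<kappa> * t)))\<^sup>2 + (max 0 (t - T))\<^sup>2"
      for x y :: 'a and t
    have G0: "0 \<le> G x t y" for x y t by (simp add: G_def)
    \<comment> \<open>An upper bound for the radius on the whole time interval, valid for either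
      sign of \<kappa>.\<close>
    define Rm where "Rm = \<rho> * exp (\<bar>\<kappa>\<bar> * (T + 1))"
    have Rm: "\<rho> * exp (\<kappa> * t) \<le> Rm" if "0 \<le> t" "t \<le> T + 1" for t
    proof -
      have "\<kappa> * t \<le> \<bar>\<kappa>\<bar> * t" using that by (intro mult_right_mono) auto
      also have "\<dots> \<le> \<bar>\<kappa>\<bar> * (T + 1)" using that by (intro mult_left_mono) auto
      finally have "\<kappa> * t \<le> \<bar>\<kappa>\<bar> * (T + 1)" .
      then show ?thesis using \<rho> by (simp add: Rm_def)
    qed
    obtain Fm where Fm: "\<And>y. y \<in> F \<Longrightarrow> norm y \<le> Fm"
      using compact_imp_bounded[OF F] by (auto simp: bounded_iff)
    \<comment> \<open>\<open>W\<close> is chosen so that beyond distance \<open>W\<close> from the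
      enlarged set the quadratic penalty dominates the linear growth bound, already with coefficient
      1. Hence nothing outside the ball of radius \<open>Q\<close> can give a positive maximum, and
      the maximisation takes place on a compact set.\<close>
    define W where "W = 1 + M + \<bar>h\<bar> + M * (Fm + Rm + 1)"
    define Q where "Q = Fm + Rm + W"
    have "0 \<le> Fm" using Fm[OF x1(1)] norm_ge_zero order_trans by blast
    moreover have "0 \<le> Rm" using \<rho> by (simp add: Rm_def)
    ultimately have W: "1 \<le> W" "0 \<le> M * (Fm + Rm + 1)" using M by (auto simp: W_def)
    have far: "v x t \<le> h + G x t y" if "y \<in> F" "0 \<le> t" "t \<le> T + 1" "Q \<le> norm x" for x t y
    proof -
      define w where "w = norm x - Fm - Rm"
      have w: "W \<le> w" using that by (simp add: w_def Q_def)
      have "norm x \<le> norm (x - y) + norm y" using norm_triangle_sub[of x y] by simp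
      then have "w \<le> norm (x - y) - \<rho> * exp (\<kappa> * t)" using Fm[OF that(1)] Rm[OF that(2,3)] by (simp add: w_def)
      then have "w\<^sup>2 \<le> (max 0 (norm (x - y) - \<rho> * exp (\<kappa> * t)))\<^sup>2" using w W by (intro power_mono) auto
      then have 1: "w\<^sup>2 \<le> G x t y" by (simp add: G_def add_increasing2)
      have "W * w \<le> w\<^sup>2" unfolding power2_eq_square using w W by (intro mult_right_mono) auto
      moreover have "(\<bar>h\<bar> + M * (Fm + Rm + 1)) * 1 \<le> (\<bar>h\<bar> + M * (Fm + Rm + 1)) * w" using w W by (intro mult_left_mono) auto
      ultimately have "M * (w + Fm + Rm + 1) \<le> h + w\<^sup>2" using w W by (simp add: W_def algebra_simps)
      with growth[OF that(2,3), of x] 1 show ?thesis by (simp add: w_def)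
    qed
    let ?v = "\<lambda>p::'a \<times> real \<times> 'a. v (fst p) (fst (snd p))"
    let ?G = "\<lambda>p::'a \<times> real \<times> 'a. G (fst p) (fst (snd p)) (snd (snd p))"
    define Z where "Z = cball (0::'a) Q \<times> {0..T + 1} \<times> F"
    have Z: "compact Z" unfolding Z_def by (intro compact_Times F) auto
    have "continuous_on Z (\<lambda>p. (\<lambda>(x, t). v x t) (fst p, fst (snd p)))"
      by (rule continuous_on_compose2[OF cont]) (auto simp: Z_def intro!: continuous_intros)
    then have contv: "continuous_on Z ?v" by simp
    have contG: "continuous_on S ?G" for S
      unfolding G_def by (intro continuous_intros)
    \<comment> \<open>\<open>S\<close> collects the points at the two ends of the time interval
      where the penalty must do the work. There \<open>G\<close> is positive: at
      \<open>t = 0\<close> because \<open>init\<close> excludes points within \<rho> of the centre,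
      at \<open>t = T + 1\<close> because of the time penalty. Compactness turns this into a uniform
      bound \<open>c\<close>.\<close>
    define S where "S = {p \<in> cball (0::'a) Q \<times> {0, T + 1} \<times> F. h + \<eta> * (1 + fst (snd p)) \<le> ?v p}"
    have S: "S \<subseteq> Z" using T by (auto simp: S_def Z_def)
    have Zb: "compact (cball (0::'a) Q \<times> {0, T + 1} \<times> F)" by (intro compact_Times F) auto
    have "closed S" unfolding S_def
      by (intro continuous_on_closed_Collect_le compact_imp_closed[OF Zb] continuous_intros continuous_on_subset[OF contv])
         (use T in \<open>auto simp: Z_def\<close>)
    then have "compact S" using compact_Int_closed[OF Z] S by (metis inf.absorb_iff2)
    have "\<exists>c>0. \<forall>p\<in>S. c \<le> ?G p"
    proof (cases "S = {}")
      case False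
      from continuous_attains_inf[OF \<open>compact S\<close> False contG] obtain p where p: "p \<in> S" "\<And>q. q \<in> S \<Longrightarrow> ?G p \<le> ?G q" by blast
      obtain x t y where [simp]: "p = (x, t, y)" by (metis surj_pair)
      have "0 < ?G p"
      proof (cases "t = 0")
        case True
        then have "h < v x 0" "y \<in> F" using p(1) \<eta> by (auto simp: S_def)
        then have "\<rho> < norm (x - y)" using init[of y x] by force
        then show ?thesis by (simp add: True G_def add_pos_nonneg)
      next
        case False
        then have "t = T + 1" using p(1) by (auto simp: S_def)
        then show ?thesis by (simp add: G_def add_nonneg_pos)
      qed
      with p show ?thesis by blast
    qed (auto intro: exI[of _ 1])
    then obtain c where c: "0 < c" "\<And>p. p \<in> S \<Longrightarrow> c \<le> ?G p" by blast
    obtain B where "\<forall>r\<in>?v ` Z. norm r \<le> B"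
      using compact_imp_bounded[OF compact_continuous_image[OF contv Z]] unfolding bounded_iff by blast
    then have B: "?v p \<le> B" if "p \<in> Z" for p
      using that by (auto intro: abs_le_D1)
    text \<open>\<open>A\<close> is so large that the maximum is not attained at \<open>t = 0\<close> or \<open>t = T + 1\<close>; in particular the
      term \<open>(t - T)\<^sub>+\<^sup>2\<close> makes the maximum one over both sides of \<open>t0\<close>, as test functions require.\<close>
    define A where "A = max 1 (\<bar>B - h\<bar> / c)"
    have A: "1 \<le> A" "B - h \<le> A * c" using c by (auto simp: A_def field_simps max_def)
    define \<Psi> where "\<Psi> x t y = v x t - (h + \<eta> * (1 + t) + A * G x t y)" for x t y
    have edge: "\<Psi> x t y \<le> 0" if "y \<in> F" "t \<in> {0, T + 1}" "norm x \<le> Q" for x t y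
    proof (cases "(x, t, y) \<in> S")
      case True
      then have "v x t \<le> B" "c \<le> G x t y" using B[of "(x, t, y)"] c(2)[of "(x, t, y)"] S by auto
      moreover have "A * c \<le> A * G x t y" using \<open>c \<le> G x t y\<close> A by (intro mult_left_mono) auto
      moreover have "0 \<le> \<eta> * (1 + t)" using that T \<eta> by auto
      ultimately show ?thesis using A unfolding \<Psi>_def by linarith
    next
      case False
      then have "v x t \<le> h + \<eta> * (1 + t)" using that by (auto simp: S_def)
      moreover have "0 \<le> A * G x t y" using A G0 by simp
      ultimately show ?thesis by (simp add: \<Psi>_def)
    qed
    have far': "\<Psi> x t y \<le> 0" if "y \<in> F" "0 \<le> t" "t \<le> T + 1" "Q \<le> norm x" for x t y
    proof -
      have "1 * G x t y \<le> A * G x t y" using A G0 by (intro mult_right_mono) auto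
      moreover have "0 \<le> \<eta> * (1 + t)" using that \<eta> by auto
      ultimately show ?thesis using far[OF that] unfolding \<Psi>_def by linarith
    qed
    have pos1: "0 < \<Psi> x1 T y1" using neg x1 by (simp add: \<Psi>_def G_def)
    then have Z1: "(x1, T, y1) \<in> Z" using far'[OF x1(1), of T x1] T x1 by (force simp: Z_def)
    have "continuous_on Z (\<lambda>p. \<Psi> (fst p) (fst (snd p)) (snd (snd p)))"
      unfolding \<Psi>_def by (intro continuous_intros contv contG)
    from continuous_attains_sup[OF Z _ this] Z1 obtain x0 t0 y0 where
      0: "(x0, t0, y0) \<in> Z" and max0: "\<And>x t y. (x, t, y) \<in> Z \<Longrightarrow> \<Psi> x t y \<le> \<Psi> x0 t0 y0"
      by force
    have pos0: "0 < \<Psi> x0 t0 y0" using max0[OF Z1] pos1 by simp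
    have y0: "y0 \<in> F" and "norm x0 \<le> Q" "0 \<le> t0" "t0 \<le> T + 1" using 0 by (auto simp: Z_def)
    then have t0: "0 < t0" "t0 < T + 1" using edge[of y0 t0 x0] pos0 by force+
    \<comment> \<open>The maximum over the compact set is positive, so it dominates the nonpositive
      values outside too. It is thus a maximum over all \<open>x\<close> and over all centres
      \<open>y\<close> in \<open>F\<close>.\<close>
    have max: "\<Psi> x t y \<le> \<Psi> x0 t0 y0" if "0 < t" "t < T + 1" "y \<in> F" for x t y
      using max0[of x t y] far'[of y t x] pos0 that by (cases "norm x \<le> Q") (force simp: Z_def)+
    define \<phi> where "\<phi> = (\<lambda>(x, t). h + \<eta> * (1 + t) + A * ((max 0 (norm (x - y0) - \<rho> * exp (\<kappa> * t)))\<^sup>2 + (max 0 (t - T))\<^sup>2))"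
    have \<phi>: "v x t - \<phi> (x, t) = \<Psi> x t y0" for x t by (simp add: \<phi>_def \<Psi>_def G_def)
    have "\<forall>\<^sub>F p in nhds (x0, t0). p \<in> UNIV \<times> {0<..<T + 1}"
      by (intro eventually_nhds_in_open open_Times) (use t0 in auto)
    then have loc: "\<forall>\<^sub>F (x, t) in nhds (x0, t0). v x t - \<phi> (x, t) \<le> v x0 t0 - \<phi> (x0, t0)"
      unfolding \<phi> by eventually_elim (auto intro: max y0)
    define w where "w = max 0 (norm (x0 - y0) - \<rho> * exp (\<kappa> * t0))"
    have w0: "0 \<le> w" by (simp add: w_def)
    have "0 \<le> \<eta> * (1 + t0)" "0 \<le> A * G x0 t0 y0" using t0 \<eta> A G0 by auto
    then have hv: "h < v x0 t0" using pos0 by (simp add: \<Psi>_def)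
    from visc[OF t0 C1_test_function_ball_barrier[OF \<rho>] loc[unfolded \<phi>_def] hv]
    obtain q where q: "\<eta> - 2 * A * w * (\<kappa> * (\<rho> * exp (\<kappa> * t0))) + 2 * A * max 0 (t0 - T)
        + norm ((2 * A * w / max (norm (x0 - y0)) (\<rho> * exp (\<kappa> * t0))) *\<^sub>R (x0 - y0)) * q \<le> 0"
      "(\<forall>z. \<forall>y\<in>F. norm (z - y) \<le> \<rho> * exp (\<kappa> * t0) \<longrightarrow> v z t0 < v x0 t0) \<Longrightarrow> \<kappa> * (\<rho> * exp (\<kappa> * t0)) \<le> q"
      by (auto simp: w_def)
    have "0 < \<rho> * exp (\<kappa> * t0)" using \<rho> by simp
    \<comment> \<open>Either \<open>w = 0\<close> and both sides vanish, or the point lies outside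
      the ball and the \<open>max\<close> is the norm itself.\<close>
    then have n: "norm ((2 * A * w / max (norm (x0 - y0)) (\<rho> * exp (\<kappa> * t0))) *\<^sub>R (x0 - y0)) = 2 * A * w"
      using A by (auto simp: w_def max_def)
    have "0 \<le> 2 * A * max 0 (t0 - T)" using A by simp
    with q(1) \<eta> have less: "2 * A * w * (q - \<kappa> * (\<rho> * exp (\<kappa> * t0))) < 0"
      unfolding n by (simp add: algebra_simps)
    \<comment> \<open>The strict inequality, which comes from \<eta>, excludes a vanishing
      gradient.\<close>
    then have "w \<noteq> 0" by auto
    with w0 have w: "0 < w" by simp
    \<comment> \<open>The spatial penalty of \<open>z\<close> with its own centre \<open>y\<close>
      is 0, while that of the maximum point is \<open>w\<^sup>2\<close>. Comparing the two values of
      \<Psi> at the common time \<open>t0\<close> leaves a gap of at least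
      \<open>A * w\<^sup>2\<close>. Maximising over the centre is essential here, since
      \<open>y\<close> may differ from \<open>y0\<close>.\<close>
    have "v z t0 < v x0 t0" if "y \<in> F" "norm (z - y) \<le> \<rho> * exp (\<kappa> * t0)" for y z
    proof -
      have "G z t0 y = (max 0 (t0 - T))\<^sup>2" "G x0 t0 y0 = w\<^sup>2 + (max 0 (t0 - T))\<^sup>2"
        using that by (auto simp: G_def w_def)
      moreover have "0 < A * w\<^sup>2" using A w by simp
      ultimately show ?thesis using max[OF t0 that(1), of z] by (simp add: \<Psi>_def algebra_simps)
    qed
    with q(2) have "0 \<le> 2 * A * w * (q - \<kappa> * (\<rho> * exp (\<kappa> * t0)))" using A w by simp
    with less show False by simp
  qed
  from this[of "e / (1 + T)" for e] T have "v x1 T \<le> h + e" if "0 < e" for e using that by force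
  then show ?thesis by (rule field_le_epsilon)
qed

section \<open>Parallel sets\<close>

lemma set_edist_eq_infdist:
  assumes "A \<noteq> {}"
  shows "set_edist x A = ereal (infdist x A)"
proof -
  have "ereal (Inf (dist x ` A)) = (INF r\<in>dist x ` A. ereal r)"
    using assms by (intro ereal_Inf' bdd_belowI[of _ 0]) auto
  then show ?thesis using assms by (simp add: set_edist_def infdist_notempty image_comp o_def)
qed

text \<open>For nonnegative \<open>s\<close> every point of the sublevel set qualifies, and outside
  it the distance to the complement vanishes, so only the ordinary distance remains.\<close>

lemma E_par_eq_infdist:
  assumes "{y. u0 y \<le> h} \<noteq> {}" "0 \<le> s" and closed: "closed {y. u0 y \<le> h}"
  shows "E_par u0 h s = {x. infdist x {y. u0 y \<le> h} \<le> s}"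
proof -
  let ?A = "{y. u0 y \<le> h}"
  have "signed_dist x ?A \<le> ereal s \<longleftrightarrow> infdist x ?A \<le> s" for x
  proof (cases "x \<in> ?A")
    case True
    then have "signed_dist x ?A \<le> 0"
      using set_edist_nonneg[of x "- ?A"] by (simp add: signed_dist_def set_edist_mem)
    also have "0 \<le> ereal s" using assms by simp
    finally show ?thesis using True assms by simp
  next
    case False
    then have "set_edist x (- ?A) = 0" by (intro set_edist_mem) auto
    then show ?thesis using assms by (simp add: signed_dist_def set_edist_eq_infdist)
  qed
  then show ?thesis by (simp add: E_par_def)
qed

text \<open>A signed distance below \<open>- s\<close> can occur only inside the sublevel set, where
  it is minus the distance to the superlevel set. The inner parallel set thus becomes the complement
  of a neighbourhood of the superlevel set, the form that the spreading argument for
  \<open>- u\<close> uses.\<close>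

lemma D_par_eq_infdist:
  assumes "{y. h \<le> u0 y} \<noteq> {}" "0 \<le> s"
  shows "D_par u0 h (- s) = {x. s < infdist x {y. h \<le> u0 y}}"
proof -
  let ?A = "{y. u0 y < h}"
  have compl: "- ?A = {y. h \<le> u0 y}" by auto
  have "signed_dist x ?A < ereal (- s) \<longleftrightarrow> s < infdist x {y. h \<le> u0 y}" for x
  proof (cases "x \<in> ?A")
    case True
    then have "signed_dist x ?A = - ereal (infdist x {y. h \<le> u0 y})"
      unfolding signed_dist_def compl using assms by (simp add: set_edist_mem set_edist_eq_infdist)
    then show ?thesis by simp
  next
    case False
    then have "signed_dist x ?A = set_edist x ?A"
      by (simp add: signed_dist_def compl set_edist_mem)
    moreover have "ereal (- s) \<le> 0" using assms by simp
    ultimately have "\<not> signed_dist x ?A < ereal (- s)"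
      using set_edist_nonneg[of x ?A] by (metis not_less order_trans)
    then show ?thesis using False assms by simp
  qed
  then show ?thesis by (simp add: D_par_def)
qed

text \<open>A closed set contains a nearest point. This supplies the centre \<open>y\<close> that
  the comparison works with.\<close>

lemma infdist_le_iff_closed:
  fixes A :: "'a::euclidean_space set"
  assumes "closed A" "A \<noteq> {}"
  shows "infdist x A \<le> s \<longleftrightarrow> (\<exists>y\<in>A. norm (x - y) \<le> s)"
proof
  assume s: "infdist x A \<le> s"
  obtain y where y: "y \<in> A" "\<And>z. z \<in> A \<Longrightarrow> dist x y \<le> dist x z"
    using distance_attains_inf[OF assms] by blast
  then have "dist x y \<le> infdist x A"
    using assms by (auto simp: infdist_notempty intro: cINF_greatest)
  with s y show "\<exists>y\<in>A. norm (x - y) \<le> s" by (force simp: dist_norm)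
qed (auto simp: dist_norm intro: infdist_le2)

section \<open>Spreading of sublevel and superlevel sets\<close>

text \<open>The comparison runs up to time \<open>T + 1\<close>, where the radius has outgrown its
  value \<open>C\<close> at time \<open>T\<close>. With rate at most 1 it has grown by a factor of
  at most \<open>exp 1\<close>, so speed bounds up to \<open>3 * C\<close> suffice.\<close>

lemma exponential_radius_bound:
  fixes a C t T :: real
  assumes "0 \<le> a" "a \<le> 1" "0 \<le> C" "t \<le> T + 1"
  shows "C * exp (- a * T) * exp (a * t) \<le> 3 * C"
proof -
  have "a * (t - T) \<le> 1"
    using assms mult_mono[of a 1 "t - T" 1] by (cases "t \<le> T") (auto intro: order_trans[OF mult_nonneg_nonpos])
  then have "exp (a * (t - T)) \<le> exp 1" by simp
  also have "\<dots> \<le> 3" by (rule exp_le)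
  finally have *: "exp (- a * T) * exp (a * t) \<le> 3" by (simp flip: exp_add add: algebra_simps)
  then show ?thesis using mult_left_mono[OF * \<open>0 \<le> C\<close>] by (simp add: mult_ac)
qed

lemma sets_lebesgue_infdist:
  fixes A :: "'a::euclidean_space set"
  shows "{x. infdist x A \<le> s} \<in> sets lebesgue" "{x. s < infdist x A} \<in> sets lebesgue"
proof -
  have "closed {x. infdist x A \<le> s}" "open {x. s < infdist x A}"
    by (intro closed_Collect_le open_Collect_less continuous_intros)+
  then show "{x. infdist x A \<le> s} \<in> sets lebesgue" "{x. s < infdist x A} \<in> sets lebesgue"
    by (metis borel_open borel_closed sets_completionI_sets sets_lborel)+
qed

text \<open>These are the consequences of the structural assumptions that the spreading arguments
  use; both monotonicity conditions on \<open>f\<close> are merged into \<open>f_mono\<close>, and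
  the integral form of \<mu> is left behind.\<close>

locale level_set_flow =
  fixes f :: "real \<Rightarrow> real \<Rightarrow> real"
    and \<mu> :: "'a::euclidean_space set \<Rightarrow> real"
    and u0 :: "'a \<Rightarrow> real"
    and u :: "'a \<Rightarrow> real \<Rightarrow> real"
    and B :: real
  assumes f_bounded: "\<And>r q. 0 \<le> q \<Longrightarrow> \<bar>f r q\<bar> \<le> B"
    and f_mono: "\<And>r1 r2 q1 q2. r1 \<le> r2 \<Longrightarrow> 0 \<le> q1 \<Longrightarrow> q1 \<le> q2 \<Longrightarrow> f r1 q1 \<le> f r2 q2"
    and \<mu>_nonneg: "\<And>A. A \<in> sets lebesgue \<Longrightarrow> 0 \<le> \<mu> A"
    and \<mu>_mono: "\<And>A C. A \<in> sets lebesgue \<Longrightarrow> C \<in> sets lebesgue \<Longrightarrow> A \<subseteq> C \<Longrightarrow> \<mu> A \<le> \<mu> C"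
    and solution: "cauchy_viscosity_solution f \<mu> u0 u"
    and growth: "linear_growth u"
begin

section \<open>Continuity of the solution in space and measurability of its sublevel sets\<close>

lemma u_initial: "u x 0 = u0 x"
  using solution by (simp add: cauchy_viscosity_solution_def)

lemma continuous_u: "continuous_on (UNIV \<times> {0..}) (\<lambda>(x, t). u x t)"
  using solution by (simp add: cauchy_viscosity_solution_def)

lemma continuous_u_time:
  assumes "0 \<le> t"
  shows "continuous_on UNIV (\<lambda>x. u x t)"
proof -
  have "continuous_on UNIV (\<lambda>x. (\<lambda>(x, t). u x t) (x, t))"
    by (rule continuous_on_compose2[OF continuous_u]) (use assms in \<open>auto intro!: continuous_intros\<close>)
  then show ?thesis by simp
qed

lemma sets_sublevel:
  assumes "0 \<le> t"
  shows "{x. u x t < c} \<in> sets lebesgue" "{x. u x t \<le> c} \<in> sets lebesgue"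
  using open_Collect_less[OF continuous_u_time[OF assms] continuous_on_const]
    closed_Collect_le[OF continuous_u_time[OF assms] continuous_on_const]
  by (metis borel_open borel_closed sets_completionI_sets sets_lborel)+

text \<open>Two levels occur because the speed is known at \<open>h0\<close> while the initial
  neighbourhood lies only below the slightly higher \<open>h\<close>; monotonicity of
  \<open>f\<close> in its first argument bridges them. The sublevel set of \<open>u\<close> is not
  explicit, so \<open>speed\<close> is required for every measurable \<open>S\<close> containing the
  current neighbourhood of \<open>F\<close>.\<close>

lemma sublevel_set_spreads:
  assumes F: "compact F" and "0 < \<rho>" "0 \<le> T" and h: "h0 \<le> h"
    and init: "\<And>x y. y \<in> F \<Longrightarrow> norm (x - y) \<le> \<rho> \<Longrightarrow> u0 x \<le> h"
    and speed: "\<And>t S. 0 < t \<Longrightarrow> t < T + 1 \<Longrightarrow> S \<in> sets lebesgue \<Longrightarrow>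
      (\<And>z y. y \<in> F \<Longrightarrow> norm (z - y) \<le> \<rho> * exp (\<kappa> * t) \<Longrightarrow> z \<in> S) \<Longrightarrow>
      \<kappa> * (\<rho> * exp (\<kappa> * t)) \<le> f h0 (\<mu> S)"
    and x: "y \<in> F" "norm (x - y) \<le> \<rho> * exp (\<kappa> * T)"
  shows "u x T \<le> h"
proof -
  obtain M where M: "0 < M" "\<And>x t. 0 \<le> t \<Longrightarrow> t \<le> T + 1 \<Longrightarrow> \<bar>u x t\<bar> \<le> M * (norm x + 1)"
    using growth \<open>0 \<le> T\<close> unfolding linear_growth_def by (auto dest!: spec[of _ "T + 1"])
  show ?thesis
  proof (rule ball_barrier_comparison[where v = u and F = F and M = M])
    show "u x 0 \<le> h" if "y \<in> F" "norm (x - y) \<le> \<rho>" for x y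
      using init[OF that] by (simp add: u_initial)
  next
    fix \<phi> \<phi>x \<phi>t x0 t0
    assume t0: "0 < t0" "t0 < T + 1" and test: "C1_test_function \<phi> \<phi>x \<phi>t"
      and max: "\<forall>\<^sub>F (x, t) in nhds (x0, t0). u x t - \<phi> (x, t) \<le> u x0 t0 - \<phi> (x0, t0)"
      and hu: "h < u x0 t0"
    let ?S = "{y. u y t0 < u x0 t0}"
    have S: "?S \<in> sets lebesgue" using t0 by (intro sets_sublevel) auto
    show "\<exists>q. \<phi>t (x0, t0) + norm (\<phi>x (x0, t0)) * q \<le> 0 \<and>
          ((\<forall>z. \<forall>y\<in>F. norm (z - y) \<le> \<rho> * exp (\<kappa> * t0) \<longrightarrow> u z t0 < u x0 t0) \<longrightarrow>
           \<kappa> * (\<rho> * exp (\<kappa> * t0)) \<le> q)"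
    proof (intro exI conjI impI)
      show "\<phi>t (x0, t0) + norm (\<phi>x (x0, t0)) * f (u x0 t0) (\<mu> ?S) \<le> 0"
        using solution t0 test max
        unfolding cauchy_viscosity_solution_def viscosity_subsolution_def by blast
      assume "\<forall>z. \<forall>y\<in>F. norm (z - y) \<le> \<rho> * exp (\<kappa> * t0) \<longrightarrow> u z t0 < u x0 t0"
      then have "\<kappa> * (\<rho> * exp (\<kappa> * t0)) \<le> f h0 (\<mu> ?S)" using speed[OF t0 S] by auto
      also have "\<dots> \<le> f (u x0 t0) (\<mu> ?S)" using h hu S by (intro f_mono \<mu>_nonneg) auto
      finally show "\<kappa> * (\<rho> * exp (\<kappa> * t0)) \<le> f (u x0 t0) (\<mu> ?S)" .
    qed
  qed (use assms M continuous_u in \<open>auto intro: order_trans[OF abs_ge_self]\<close>)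
qed

text \<open>The comparison is applied to \<open>- u\<close>, with the supersolution inequality
  tested by \<open>- \<phi>\<close>. Here \<open>speed\<close> may also assume that \<open>S\<close>
  lies in \<open>{z. u z t < h}\<close>; this is what later allows a noncompact superlevel set to be
  cut off.\<close>

lemma superlevel_set_spreads:
  assumes F: "compact F" and "0 < \<rho>" "0 \<le> T" and h: "h \<le> h0"
    and init: "\<And>x y. y \<in> F \<Longrightarrow> norm (x - y) \<le> \<rho> \<Longrightarrow> h \<le> u0 x"
    and speed: "\<And>t S. 0 < t \<Longrightarrow> t < T + 1 \<Longrightarrow> S \<in> sets lebesgue \<Longrightarrow>
      (\<And>z. z \<in> S \<Longrightarrow> u z t < h) \<Longrightarrow>
      (\<And>z y. y \<in> F \<Longrightarrow> norm (z - y) \<le> \<rho> * exp (\<kappa> * t) \<Longrightarrow> z \<notin> S) \<Longrightarrow>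
      f h0 (\<mu> S) \<le> - (\<kappa> * (\<rho> * exp (\<kappa> * t)))"
    and x: "y \<in> F" "norm (x - y) \<le> \<rho> * exp (\<kappa> * T)"
  shows "h \<le> u x T"
proof -
  obtain M where M: "0 < M" "\<And>x t. 0 \<le> t \<Longrightarrow> t \<le> T + 1 \<Longrightarrow> \<bar>u x t\<bar> \<le> M * (norm x + 1)"
    using growth \<open>0 \<le> T\<close> unfolding linear_growth_def by (auto dest!: spec[of _ "T + 1"])
  have "- u x T \<le> - h"
  proof (rule ball_barrier_comparison[where v = "\<lambda>x t. - u x t" and F = F and M = M])
    show "- u x 0 \<le> - h" if "y \<in> F" "norm (x - y) \<le> \<rho>" for x y
      using init[OF that] by (simp add: u_initial)
  next
    show "continuous_on (UNIV \<times> {0..}) (\<lambda>(x, t). - u x t)"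
      using continuous_on_minus[OF continuous_u] by (simp add: case_prod_unfold)
  next
    fix \<phi> :: "'a \<times> real \<Rightarrow> real" and \<phi>x \<phi>t x0 t0
    assume t0: "0 < t0" "t0 < T + 1" and test: "C1_test_function \<phi> \<phi>x \<phi>t"
      and max: "\<forall>\<^sub>F (x, t) in nhds (x0, t0). - u x t - \<phi> (x, t) \<le> - u x0 t0 - \<phi> (x0, t0)"
      and hu: "- h < - u x0 t0"
    let ?S = "{y. u y t0 \<le> u x0 t0}"
    have S: "?S \<in> sets lebesgue" using t0 by (intro sets_sublevel) auto
    have test': "C1_test_function (\<lambda>p. - \<phi> p) (\<lambda>p. - \<phi>x p) (\<lambda>p. - \<phi>t p)"
      unfolding C1_test_function_def
    proof (intro conjI ballI)
      fix p :: "'a \<times> real" assume "p \<in> spacetime"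
      then have "(\<phi> has_derivative (\<lambda>(y, s). \<phi>x p \<bullet> y + \<phi>t p * s)) (at p)"
        using test unfolding C1_test_function_def by blast
      from has_derivative_minus[OF this]
      show "((\<lambda>p. - \<phi> p) has_derivative (\<lambda>(y, s). - \<phi>x p \<bullet> y + - \<phi>t p * s)) (at p)"
        by (simp add: case_prod_unfold)
    qed (use test in \<open>auto simp: C1_test_function_def intro: continuous_on_minus\<close>)
    have min': "\<forall>\<^sub>F (x, t) in nhds (x0, t0). u x0 t0 - - \<phi> (x0, t0) \<le> u x t - - \<phi> (x, t)"
      using max by eventually_elim auto
    show "\<exists>q. \<phi>t (x0, t0) + norm (\<phi>x (x0, t0)) * q \<le> 0 \<and>
          ((\<forall>z. \<forall>y\<in>F. norm (z - y) \<le> \<rho> * exp (\<kappa> * t0) \<longrightarrow> - u z t0 < - u x0 t0) \<longrightarrow>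
           \<kappa> * (\<rho> * exp (\<kappa> * t0)) \<le> q)"
    proof (intro exI conjI impI)
      have "0 \<le> - \<phi>t (x0, t0) + norm (- \<phi>x (x0, t0)) * f (u x0 t0) (\<mu> ?S)"
        using solution t0 test' min'
        unfolding cauchy_viscosity_solution_def viscosity_supersolution_def by blast
      then show "\<phi>t (x0, t0) + norm (\<phi>x (x0, t0)) * - f (u x0 t0) (\<mu> ?S) \<le> 0" by simp
      assume *: "\<forall>z. \<forall>y\<in>F. norm (z - y) \<le> \<rho> * exp (\<kappa> * t0) \<longrightarrow> - u z t0 < - u x0 t0"
      have "f (u x0 t0) (\<mu> ?S) \<le> f h0 (\<mu> ?S)" using h hu S by (intro f_mono \<mu>_nonneg) auto
      \<comment> \<open>Points of the set have values at most \<open>u x0 t0 < h\<close>, while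
        points near \<open>F\<close> have larger values and so lie outside it: these are the two
        premises of \<open>speed\<close>.\<close>
      also have "\<dots> \<le> - (\<kappa> * (\<rho> * exp (\<kappa> * t0)))"
        using speed[OF t0 S] * hu by force
      finally show "\<kappa> * (\<rho> * exp (\<kappa> * t0)) \<le> - f (u x0 t0) (\<mu> ?S)" by simp
    qed
  qed (use assms M in \<open>auto simp: abs_le_iff minus_le_iff intro: order_trans[OF abs_ge_minus_self]\<close>)
  then show ?thesis by simp
qed

text \<open>Since \<open>f\<close> is bounded by \<open>B\<close>, a ball on which \<open>u0\<close>
  is at least \<open>h\<close> cannot be eroded faster than \<open>B\<close>. The comparison uses
  \<open>F = {x}\<close> and the shrinking radius \<open>(B + 1) * exp (T + 1 - s)\<close>, whose
  rate of decrease is at least \<open>B\<close> for all times before \<open>T + 1\<close>.\<close>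

lemma finite_speed:
  assumes far: "\<And>x. P \<le> norm x \<Longrightarrow> h \<le> u0 x"
  obtains Q where "\<And>x t. Q \<le> norm x \<Longrightarrow> 0 \<le> t \<Longrightarrow> t \<le> T \<Longrightarrow> h \<le> u x t"
proof
  fix x :: 'a and t
  define \<rho> where "\<rho> = (B + 1) * exp (T + 1)"
  assume x: "P + (B + 1) * exp (T + 1) \<le> norm x" and t: "0 \<le> t" "t \<le> T"
  have B: "0 \<le> B" using f_bounded[of 0 0] by simp
  then have \<rho>: "0 < \<rho>" by (simp add: \<rho>_def)
  show "h \<le> u x t"
  proof (rule superlevel_set_spreads[where F = "{x}" and \<rho> = \<rho> and \<kappa> = "-1" and T = t])
    fix z y assume "y \<in> {x}" "norm (z - y) \<le> \<rho>"
    then have "P \<le> norm z" using x norm_triangle_sub[of x z] by (simp add: \<rho>_def norm_minus_commute)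
    then show "h \<le> u0 z" by (rule far)
  next
    fix s and S :: "'a set" assume s: "s < t + 1" "S \<in> sets lebesgue"
    have "B * 1 \<le> (B + 1) * exp (T + 1 - s)" using B s t by (intro mult_mono) auto
    also have "\<dots> = \<rho> * exp (-1 * s)" by (simp add: \<rho>_def exp_diff exp_minus field_simps)
    finally show "f h (\<mu> S) \<le> - (- 1 * (\<rho> * exp (- 1 * s)))"
      using f_bounded[OF \<mu>_nonneg[OF s(2)], of h] by simp
  qed (use t \<rho> in auto)
qed

text \<open>For each target time \<open>T\<close> a separate barrier is used: its initial radius
  \<rho> is tuned so that it reaches exactly \<open>C\<close> at time \<open>T\<close>, which covers
  \<open>K\<close>. The price is the level \<open>h + g \<rho>\<close>, and \<rho> decays
  exponentially in \<open>T\<close>.\<close>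

lemma upper_estimate:
  assumes E: "compact {x. u0 x \<le> h}" "{x. u0 x \<le> h} \<noteq> {}"
    and speed: "\<And>C. 0 < C \<Longrightarrow> \<exists>a>0. a \<le> 1 \<and> (\<forall>s. 0 \<le> s \<longrightarrow> s \<le> C \<longrightarrow>
      a * s \<le> f h (\<mu> {x. infdist x {x. u0 x \<le> h} \<le> s}))"
    and g: "mono_on {0..} g" "\<And>r. 0 \<le> r \<Longrightarrow> 0 \<le> g r" "\<And>x y. u0 x - u0 y \<le> g (norm (x - y))"
    and K: "compact K"
  obtains C lam where "0 < C" "0 < lam" "\<And>x t. x \<in> K \<Longrightarrow> 0 \<le> t \<Longrightarrow> u x t \<le> h + g (C * exp (- lam * t))"
proof -
  let ?E = "{x. u0 x \<le> h}"
  obtain y0 where y0: "y0 \<in> ?E" using E by blast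
  obtain C where C: "0 < C" "K \<subseteq> ball y0 C"
    using bounded_subset_ballD[OF compact_imp_bounded[OF K]] by metis
  obtain a where a: "0 < a" "a \<le> 1"
    and sp: "\<And>s. 0 \<le> s \<Longrightarrow> s \<le> 3 * C \<Longrightarrow> a * s \<le> f h (\<mu> {x. infdist x ?E \<le> s})"
    using speed[of "3 * C"] C by auto
  show thesis
  proof (rule that[OF C(1) a(1)])
    fix x T assume x: "x \<in> K" and T: "(0::real) \<le> T"
    define \<rho> where "\<rho> = C * exp (- a * T)"
    have \<rho>: "0 < \<rho>" using C by (simp add: \<rho>_def)
    have R: "\<rho> * exp (a * T) = C" by (simp add: \<rho>_def exp_minus)
    show "u x T \<le> h + g (C * exp (- a * T))"
      unfolding \<rho>_def[symmetric]
    proof (rule sublevel_set_spreads[where F = ?E and \<rho> = \<rho> and h = "h + g \<rho>" and ?h0.0 = h and \<kappa> = a and y = y0])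
      fix z y assume "y \<in> ?E" and n: "norm (z - y) \<le> \<rho>"
      then have "u0 z \<le> h + g (norm (z - y))" using g(3)[of z y] by simp
      also have "g (norm (z - y)) \<le> g \<rho>" using n \<rho> by (intro mono_onD[OF g(1)]) auto
      finally show "u0 z \<le> h + g \<rho>" by simp
    next
      fix t S assume t: "0 < t" "t < T + 1" and S: "S \<in> sets lebesgue"
        and sub: "\<And>z y. y \<in> ?E \<Longrightarrow> norm (z - y) \<le> \<rho> * exp (a * t) \<Longrightarrow> z \<in> S"
      have "\<rho> * exp (a * t) \<le> 3 * C"
        unfolding \<rho>_def by (rule exponential_radius_bound) (use a C t in auto)
      then have "a * (\<rho> * exp (a * t)) \<le> f h (\<mu> {x. infdist x ?E \<le> \<rho> * exp (a * t)})" using \<rho> by (intro sp) auto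
      \<comment> \<open>Every point within the radius of the set has a centre in it, so the closed
        neighbourhood is contained in \<open>S\<close>.\<close>
      also have "\<dots> \<le> f h (\<mu> S)"
      proof (intro f_mono \<mu>_nonneg \<mu>_mono order_refl)
        show "{x. infdist x ?E \<le> \<rho> * exp (a * t)} \<subseteq> S"
          using sub infdist_le_iff_closed[OF compact_imp_closed[OF E(1)] E(2)] by auto
        show "{x. infdist x ?E \<le> \<rho> * exp (a * t)} \<in> sets lebesgue"
          by (rule sets_lebesgue_infdist)
      qed (use S in \<open>auto intro: sets_lebesgue_infdist\<close>)
      finally show "a * (\<rho> * exp (a * t)) \<le> f h (\<mu> S)" .
    next
      show "norm (x - y0) \<le> \<rho> * exp (a * T)" using C x by (auto simp: R dist_norm norm_minus_commute subset_iff less_imp_le)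
    qed (use E T g \<rho> y0 in auto)
  qed
qed

text \<open>The mirror image of the upper bound, except that the superlevel set is unbounded and has
  to be truncated to a compact \<open>F'\<close> before the comparison applies.\<close>

lemma lower_estimate:
  assumes F: "closed {x. h \<le> u0 x}" and far: "\<And>x. P \<le> norm x \<Longrightarrow> h \<le> u0 x"
    and speed: "\<And>C. 0 < C \<Longrightarrow> \<exists>a>0. a \<le> 1 \<and> (\<forall>s. 0 < s \<longrightarrow> s \<le> C \<longrightarrow>
      f h (\<mu> {x. s < infdist x {x. h \<le> u0 x}}) \<le> - (a * s))"
    and g: "mono_on {0..} g" "\<And>r. 0 \<le> r \<Longrightarrow> 0 \<le> g r" "\<And>x y. u0 x - u0 y \<le> g (norm (x - y))"
    and K: "compact K"
  obtains C lam where "0 < C" "0 < lam" "\<And>x t. x \<in> K \<Longrightarrow> 0 \<le> t \<Longrightarrow> h - g (C * exp (- lam * t)) \<le> u x t"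
proof -
  let ?F = "{x. h \<le> u0 x}"
  obtain y0 :: 'a where "norm y0 = \<bar>P\<bar>" using vector_choose_size[of "\<bar>P\<bar>"] by auto
  then have y0: "y0 \<in> ?F" by (auto intro: far)
  obtain C where C: "0 < C" "K \<subseteq> ball y0 C"
    using bounded_subset_ballD[OF compact_imp_bounded[OF K]] by metis
  obtain a where a: "0 < a" "a \<le> 1"
    and sp: "\<And>s. 0 < s \<Longrightarrow> s \<le> 3 * C \<Longrightarrow> f h (\<mu> {x. s < infdist x ?F}) \<le> - (a * s)"
    using speed[of "3 * C"] C by auto
  show thesis
  proof (rule that[OF C(1) a(1)])
    fix x T assume x: "x \<in> K" and T: "(0::real) \<le> T"
    define \<rho> where "\<rho> = C * exp (- a * T)"
    have \<rho>: "0 < \<rho>" using C by (simp add: \<rho>_def)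
    have R: "\<rho> * exp (a * T) = C" by (simp add: \<rho>_def exp_minus)
    obtain Q where Q: "\<And>x t. Q \<le> norm x \<Longrightarrow> 0 \<le> t \<Longrightarrow> t \<le> T + 1 \<Longrightarrow> h \<le> u x t"
      using finite_speed[OF far] by blast
    \<comment> \<open>Where \<open>u < h\<close> the norm is below \<open>Q\<close>, and centres
      within \<open>3 * C\<close> of such points have norm at most \<open>Q + 3 * C\<close>; no
      relevant centre is lost. The summand \<open>norm y0\<close> keeps \<open>y0\<close> in the
      set.\<close>
    define F' where "F' = ?F \<inter> cball 0 (\<bar>Q\<bar> + 3 * C + norm y0)"
    have "compact F'" unfolding F'_def by (intro closed_Int_compact F compact_cball)
    show "h - g (C * exp (- a * T)) \<le> u x T"
      unfolding \<rho>_def[symmetric]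
    proof (rule superlevel_set_spreads[where F = F' and \<rho> = \<rho> and h = "h - g \<rho>" and ?h0.0 = h and \<kappa> = a and y = y0])
      fix z y assume "y \<in> F'" and n: "norm (z - y) \<le> \<rho>"
      then have "h - g (norm (y - z)) \<le> u0 z" using g(3)[of y z] by (simp add: F'_def)
      moreover have "g (norm (y - z)) \<le> g \<rho>"
        using n \<rho> by (intro mono_onD[OF g(1)]) (auto simp: norm_minus_commute)
      ultimately show "h - g \<rho> \<le> u0 z" by simp
    next
      fix t S assume t: "0 < t" "t < T + 1" and S: "S \<in> sets lebesgue"
        and low: "\<And>z. z \<in> S \<Longrightarrow> u z t < h - g \<rho>"
        and sub: "\<And>z y. y \<in> F' \<Longrightarrow> norm (z - y) \<le> \<rho> * exp (a * t) \<Longrightarrow> z \<notin> S"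
      have R3: "\<rho> * exp (a * t) \<le> 3 * C"
        unfolding \<rho>_def by (rule exponential_radius_bound) (use a C t in auto)
      \<comment> \<open>Although \<open>S\<close> avoids only the neighbourhood of
        \<open>F'\<close>, it also avoids that of the full superlevel set: a violating centre would
        be close to a point of \<open>S\<close>, hence bounded, hence in \<open>F'\<close>.\<close>
      have "f h (\<mu> S) \<le> f h (\<mu> {x. \<rho> * exp (a * t) < infdist x ?F})"
      proof (intro f_mono \<mu>_nonneg \<mu>_mono order_refl subsetI CollectI)
        show "{x. \<rho> * exp (a * t) < infdist x ?F} \<in> sets lebesgue"
          by (rule sets_lebesgue_infdist)
        fix z assume z: "z \<in> S"
        then have "u z t < h" using low[OF z] g(2)[of \<rho>] \<rho> by simp
        then have zQ: "norm z < Q" using Q[of z t] t by force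
        show "\<rho> * exp (a * t) < infdist z ?F"
        proof (rule ccontr)
          assume "\<not> \<rho> * exp (a * t) < infdist z ?F"
          then obtain y where y: "y \<in> ?F" "norm (z - y) \<le> \<rho> * exp (a * t)"
            using infdist_le_iff_closed[OF F] y0 by (auto simp: not_less)
          then have "norm y \<le> Q + 3 * C" using R3 zQ norm_triangle_sub[of y z] by (simp add: norm_minus_commute)
          then have "y \<in> F'" using y norm_ge_zero[of y0] unfolding F'_def by (auto simp del: norm_ge_zero)
          with sub y z show False by blast
        qed
      qed (use S in auto)
      also have "\<dots> \<le> - (a * (\<rho> * exp (a * t)))" using \<rho> R3 by (intro sp) auto
      finally show "f h (\<mu> S) \<le> - (a * (\<rho> * exp (a * t)))" .
    next
      show "norm (x - y0) \<le> \<rho> * exp (a * T)" using C x by (auto simp: R dist_norm norm_minus_commute subset_iff less_imp_le)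
      show "y0 \<in> F'" using y0 C by (simp add: F'_def)
    qed (use T g \<rho> \<open>compact F'\<close> in auto)
  qed
qed

end

section \<open>Exponential convergence\<close>

text \<open>The limsup condition controls only small \<open>s\<close>. Beyond \<open>s0\<close>
  monotonicity retains the bound reached at \<open>s0 / 2\<close>, and shrinking the slope makes it
  linear up to \<open>C\<close>.\<close>

lemma linear_bound_extends:
  fixes V :: "real \<Rightarrow> real"
  assumes "0 < c" "0 < s0" "0 < C"
    and near: "\<And>s. 0 < s \<Longrightarrow> s < s0 \<Longrightarrow> V s \<le> - (c * s)"
    and antimono: "\<And>r s. 0 < r \<Longrightarrow> r \<le> s \<Longrightarrow> V s \<le> V r"
  shows "\<exists>a>0. a \<le> 1 \<and> (\<forall>s. 0 < s \<longrightarrow> s \<le> C \<longrightarrow> V s \<le> - (a * s))"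
proof -
  \<comment> \<open>The three entries serve, in order, the requirement \<open>a \<le> 1\<close>, the
    range below \<open>s0\<close>, and the range from \<open>s0\<close> to \<open>C\<close>.\<close>
  define a where "a = min 1 (min c (c * s0 / (2 * C)))"
  have a: "0 < a" "a \<le> 1" "a \<le> c" using assms by (auto simp: a_def)
  have "a \<le> c * s0 / (2 * C)" by (simp add: a_def)
  then have aC: "a * C \<le> c * (s0 / 2)" using \<open>0 < C\<close> by (simp add: field_simps)
  have "V s \<le> - (a * s)" if s: "0 < s" "s \<le> C" for s
  proof (cases "s < s0")
    case True
    have "a * s \<le> c * s" using a s by (intro mult_right_mono) auto
    then show ?thesis using near[OF s(1) True] by simp
  next
    case False
    have "V s \<le> V (s0 / 2)" using False \<open>0 < s0\<close> by (intro antimono) auto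
    also have "\<dots> \<le> - (c * (s0 / 2))" using \<open>0 < s0\<close> by (intro near) auto
    also have "\<dots> \<le> - (a * C)" using aC by simp
    also have "\<dots> \<le> - (a * s)" using a s by (simp add: mult_left_mono)
    finally show ?thesis .
  qed
  with a show ?thesis by blast
qed

theorem theorem1p3:
  fixes f :: "real \<Rightarrow> real \<Rightarrow> real"
    and \<mu> :: "(real ^ 'n) set \<Rightarrow> real"
    and \<Theta> :: "real ^ 'n \<Rightarrow> real"
    and u0 :: "real ^ 'n \<Rightarrow> real"
    and hbar :: real
    and u :: "real ^ 'n \<Rightarrow> real \<Rightarrow> real"
  assumes A1_bounded: "bounded ((\<lambda>(r, q). f r q) ` (UNIV \<times> {0..}))"
    and A1_continuous: "continuous_on (UNIV \<times> {0..}) (\<lambda>(r, q). f r q)"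
    and A1_modulus: "\<exists>\<omega>. modulus \<omega> \<and> (\<forall>r. \<forall>q1\<ge>0. \<forall>q2\<ge>0. \<bar>f r q1 - f r q2\<bar> \<le> \<omega> \<bar>q1 - q2\<bar>)"
    and A2_mono: "\<And>r1 r2 q. r1 < r2 \<Longrightarrow> 0 \<le> q \<Longrightarrow> f r1 q \<le> f r2 q"
    and A2_strict: "\<And>r q1 q2. 0 \<le> q1 \<Longrightarrow> q1 < q2 \<Longrightarrow> f r q1 < f r q2"
    and A3_integrable: "integrable lebesgue \<Theta>"
    and A3_pos: "\<And>x. 0 < \<Theta> x"
    and A3_mu: "\<And>A. A \<in> sets lebesgue \<Longrightarrow> \<mu> A = (LINT x:A|lebesgue. \<Theta> x)"
    and A4_uniform: "uniformly_continuous_on UNIV u0"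
    and A4_limit: "\<exists>l :: ereal.
          ((\<lambda>R::real. INF y\<in>{y. R \<le> norm y}. ereal (u0 y)) \<longlongrightarrow> l) at_top \<and> (\<forall>x. ereal (u0 x) < l)"
    and hbar: "f hbar (\<mu> {x. u0 x < hbar}) \<le> 0" "0 \<le> f hbar (\<mu> {x. u0 x \<le> hbar})"
    and solution: "cauchy_viscosity_solution f \<mu> u0 u"
    and growth: "linear_growth u"
    and limsup: "Limsup (at_right 0) (\<lambda>s. ereal (f hbar (\<mu> (D_par u0 hbar (- s))) / s)) < 0"
    and expansion: "\<forall>\<^sub>F b in at_right 0. \<exists>a>0. \<forall>h s.
          hbar \<le> h \<longrightarrow> h \<le> hbar + b \<longrightarrow> 0 \<le> s \<longrightarrow> s \<le> 1 / b \<longrightarrow>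
          f h (\<mu> (E_par u0 h s)) - f h (\<mu> {x. u0 x \<le> h}) \<ge> a * s"
  shows
    "(\<forall>g. modulus g \<longrightarrow> (\<forall>x y. \<bar>u0 x - u0 y\<bar> \<le> g (norm (x - y))) \<longrightarrow>
        (\<forall>K. compact K \<longrightarrow>
          (\<exists>C>0. \<exists>lam>0. \<forall>\<^sub>F t in at_top. \<forall>x\<in>K. \<bar>u x t - hbar\<bar> \<le> g (C * exp (- lam * t)))))
     \<and>
     (\<forall>\<alpha> L. 0 < \<alpha> \<longrightarrow> \<alpha> \<le> 1 \<longrightarrow> 0 < L \<longrightarrow>
        (\<forall>x y. \<bar>u0 x - u0 y\<bar> \<le> L * norm (x - y) powr \<alpha>) \<longrightarrow>
        (\<forall>K. compact K \<longrightarrow>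
          (\<exists>lam>0. \<exists>C>0. \<forall>\<^sub>F t in at_top. \<forall>x\<in>K.
             \<bar>u x t - hbar\<bar> \<le> L * (C * exp (- lam * t)) powr \<alpha>) \<and>
          (\<forall>lam>0. 
             (\<exists>C>0. \<forall>\<^sub>F t in at_top. \<forall>x\<in>K.
                \<bar>u x t - hbar\<bar> \<le> L * (C * exp (- lam * t)) powr \<alpha>) \<longrightarrow>
             (\<exists>C'>0. \<forall>\<^sub>F t in at_top. \<forall>x\<in>K. \<bar>u x t - hbar\<bar> \<le> C' * exp (- \<alpha> * lam * t)))))"
proof -

  \<comment> \<open>Structural consequences of the assumptions on \<open>f\<close> and \<mu>\<close>
  obtain B where "\<forall>r\<in>(\<lambda>(r, q). f r q) ` (UNIV \<times> {0..}). norm r \<le> B"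
    using A1_bounded unfolding bounded_iff by blast
  then have B: "\<bar>f r q\<bar> \<le> B" if "0 \<le> q" for r q using that by force
  have f_mono: "f r1 q1 \<le> f r2 q2" if "r1 \<le> r2" "0 \<le> q1" "q1 \<le> q2" for r1 r2 q1 q2
  proof -
    have "f r1 q1 \<le> f r1 q2" using A2_strict[of q1 q2 r1] that by (cases "q1 = q2") auto
    also have "\<dots> \<le> f r2 q2" using A2_mono[of r1 r2 q2] that by (cases "r1 = r2") auto
    finally show ?thesis .
  qed
  have \<Theta>_int: "integrable lebesgue (\<lambda>x. indicator A x *\<^sub>R \<Theta> x)" if "A \<in> sets lebesgue" for A
    using that A3_integrable by (rule integrable_mult_indicator)
  have \<mu>_nonneg: "0 \<le> \<mu> A" if "A \<in> sets lebesgue" for A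
    unfolding A3_mu[OF that] set_lebesgue_integral_def
    by (intro Bochner_Integration.integral_nonneg) (simp add: less_imp_le[OF A3_pos])
  have \<mu>_mono: "\<mu> A \<le> \<mu> C" if "A \<in> sets lebesgue" "C \<in> sets lebesgue" "A \<subseteq> C" for A C
    unfolding A3_mu[OF that(1)] A3_mu[OF that(2)] set_lebesgue_integral_def
    using that by (intro Bochner_Integration.integral_mono \<Theta>_int) (auto simp: indicator_def less_imp_le[OF A3_pos])
  interpret level_set_flow f \<mu> u0 u B
    by unfold_locales (fact B f_mono \<mu>_nonneg \<mu>_mono solution growth)+
  have cont0: "continuous_on UNIV u0" using A4_uniform by (rule uniformly_continuous_imp_continuous)
  let ?E = "{x. u0 x \<le> hbar}" and ?F = "{x. hbar \<le> u0 x}"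
  have E: "closed ?E" and F: "closed ?F"
    using cont0 by (auto intro!: closed_Collect_le)

  \<comment> \<open>Strict negativity near the level \<open>hbar\<close> and the geometry of the
    level sets of \<open>u0\<close>\<close>
  obtain r where r: "Limsup (at_right 0) (\<lambda>s. ereal (f hbar (\<mu> (D_par u0 hbar (- s))) / s)) < ereal r" "r < 0"
    using ereal_dense2[OF limsup] by (auto simp: zero_ereal_def)
  have "\<forall>\<^sub>F s in at_right 0. f hbar (\<mu> (D_par u0 hbar (- s))) / s < r"
    using Limsup_lessD[OF r(1)] by simp
  then obtain s0 where s0: "0 < s0" "\<And>s. 0 < s \<Longrightarrow> s < s0 \<Longrightarrow> f hbar (\<mu> (D_par u0 hbar (- s))) / s < r"
    unfolding eventually_at_right_field by auto
  have near: "f hbar (\<mu> (D_par u0 hbar (- s))) \<le> - (- r * s)" if "0 < s" "s < s0" for s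
    using s0(2)[OF that] that by (simp add: field_simps less_imp_le)
  \<comment> \<open>One strictly negative value of \<open>f\<close> is enough to rule out the two
    degenerate positions of \<open>hbar\<close> below, in each of which the parallel set would
    coincide with \<open>{x. u0 x \<le> hbar}\<close>.\<close>
  have "r * (s0 / 2) < 0" using r s0 by (simp add: mult_neg_pos)
  with near[of "s0 / 2"] s0 have neg: "f hbar (\<mu> (D_par u0 hbar (- (s0 / 2)))) < 0" by simp
  have E_ne: "?E \<noteq> {}"
  proof
    assume e: "?E = {}"
    then have "?F = UNIV" by (auto simp: set_eq_iff not_le less_imp_le)
    then have "D_par u0 hbar (- (s0 / 2)) = {}" using s0 by (subst D_par_eq_infdist) auto
    with neg hbar(2) e show False by simp
  qed
  obtain l where l: "((\<lambda>R::real. INF y\<in>{y. R \<le> norm y}. ereal (u0 y)) \<longlongrightarrow> l) at_top" "\<And>x. ereal (u0 x) < l"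
    using A4_limit by blast
  have "ereal hbar < l"
  proof (rule ccontr)
    assume "\<not> ereal hbar < l"
    then have "u0 x < hbar" for x using l(2)[of x] by (metis ereal_less_eq(3) not_le order_less_le_trans)
    \<comment> \<open>With an empty complement the distance to it is infinite, so every signed
      distance is minus infinity and the parallel set is the whole space.\<close>
    then have "{x. u0 x < hbar} = UNIV" "?E = UNIV" by (auto simp: less_imp_le)
    then have "D_par u0 hbar (- (s0 / 2)) = ?E"
      by (auto simp: D_par_def signed_dist_def set_edist_mem) (auto simp: set_edist_def top_ereal_def)
    with neg hbar(2) show False by simp
  qed
  from order_tendstoD(1)[OF l(1) this] obtain P where
    "\<And>R. P \<le> R \<Longrightarrow> ereal hbar < (INF y\<in>{y. R \<le> norm y}. ereal (u0 y))"
    unfolding eventually_at_top_linorder by blast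
  from less_INF_D[OF this[OF order_refl]] have P: "hbar < u0 y" if "P \<le> norm y" for y using that by simp
  have "?E \<subseteq> cball 0 P" by (auto simp: mem_cball_0) (metis P linear not_le)
  then have Ec: "compact ?E" using E by (simp add: compact_eq_bounded_closed bounded_subset[OF bounded_cball])
  have F_ne: "?F \<noteq> {}"
    using vector_choose_size[of "\<bar>P\<bar>"] P by (metis abs_ge_self abs_ge_zero emptyE less_imp_le mem_Collect_eq)

  \<comment> \<open>Linear speed bounds for both families of parallel sets\<close>
  have speed_E: "\<exists>a>0. a \<le> 1 \<and> (\<forall>s. 0 \<le> s \<longrightarrow> s \<le> C \<longrightarrow> a * s \<le> f hbar (\<mu> {x. infdist x ?E \<le> s}))"
    if C: "0 < C" for C
  proof -
    from expansion obtain b0 where b0: "0 < b0" "\<And>b. 0 < b \<Longrightarrow> b < b0 \<Longrightarrow> \<exists>a>0. \<forall>h s.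
          hbar \<le> h \<longrightarrow> h \<le> hbar + b \<longrightarrow> 0 \<le> s \<longrightarrow> s \<le> 1 / b \<longrightarrow>
          f h (\<mu> (E_par u0 h s)) - f h (\<mu> {x. u0 x \<le> h}) \<ge> a * s"
      unfolding eventually_at_right_field by auto
    \<comment> \<open>Small enough for the expansion hypothesis and for
      \<open>C \<le> 1 / b\<close>. The hypothesis is then applied at \<open>h = hbar\<close>, where
      the subtracted term is nonnegative by the choice of \<open>hbar\<close>.\<close>
    define b where "b = min (b0 / 2) (1 / C)"
    have b: "0 < b" "b < b0" using b0 C by (auto simp: b_def)
    have "b \<le> 1 / C" by (simp add: b_def)
    then have "C \<le> 1 / b" using b C by (simp add: field_simps)
    with b0(2)[OF b] b obtain a where a: "0 < a"
      "\<And>s. 0 \<le> s \<Longrightarrow> s \<le> C \<Longrightarrow> f hbar (\<mu> (E_par u0 hbar s)) - f hbar (\<mu> ?E) \<ge> a * s"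
      by (metis add_increasing2 less_imp_le order_refl order_trans)
    have "min a 1 * s \<le> f hbar (\<mu> {x. infdist x ?E \<le> s})" if s: "0 \<le> s" "s \<le> C" for s
    proof -
      have "min a 1 * s \<le> a * s" using s by (intro mult_right_mono) auto
      also have "\<dots> \<le> f hbar (\<mu> (E_par u0 hbar s))" using a(2)[OF s] hbar(2) by simp
      finally show ?thesis using s E E_ne by (simp add: E_par_eq_infdist)
    qed
    then show ?thesis using a(1) by (intro exI[of _ "min a 1"]) auto
  qed
  have speed_F: "\<exists>a>0. a \<le> 1 \<and> (\<forall>s. 0 < s \<longrightarrow> s \<le> C \<longrightarrow> f hbar (\<mu> {x. s < infdist x ?F}) \<le> - (a * s))"
    if C: "0 < C" for C
  proof (rule linear_bound_extends[where c = "- r" and ?s0.0 = s0])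
    show "f hbar (\<mu> {x. s < infdist x ?F}) \<le> - (- r * s)" if "0 < s" "s < s0" for s
      using near[OF that] F_ne that by (simp add: D_par_eq_infdist)
    show "f hbar (\<mu> {x. s < infdist x ?F}) \<le> f hbar (\<mu> {x. q < infdist x ?F})" if "q \<le> s" for q s
      using that by (intro f_mono \<mu>_nonneg \<mu>_mono sets_lebesgue_infdist) auto
  qed (use r s0 C in auto)

  \<comment> \<open>The two-sided estimate and the Hoelder case\<close>
  have main: "\<exists>C>0. \<exists>lam>0. \<forall>\<^sub>F t in at_top. \<forall>x\<in>K. \<bar>u x t - hbar\<bar> \<le> g (C * exp (- lam * t))"
    if "modulus g" and g_bound: "\<forall>x y. \<bar>u0 x - u0 y\<bar> \<le> g (norm (x - y))" and "compact K" for g K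
  proof -
    have g: "mono_on {0..} g" "\<And>r. 0 \<le> r \<Longrightarrow> 0 \<le> g r"
      using \<open>modulus g\<close> by (auto simp: modulus_def intro: strict_mono_on_imp_mono_on)
    have g': "u0 x - u0 y \<le> g (norm (x - y))" for x y using g_bound abs_le_D1 by blast
    obtain C1 lam1 where 1: "0 < C1" "0 < lam1"
      "\<And>x t. x \<in> K \<Longrightarrow> 0 \<le> t \<Longrightarrow> u x t \<le> hbar + g (C1 * exp (- lam1 * t))"
      using upper_estimate[OF Ec E_ne speed_E g g' \<open>compact K\<close>] by blast
    obtain C2 lam2 where 2: "0 < C2" "0 < lam2"
      "\<And>x t. x \<in> K \<Longrightarrow> 0 \<le> t \<Longrightarrow> hbar - g (C2 * exp (- lam2 * t)) \<le> u x t"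
      using lower_estimate[OF F less_imp_le[OF P] speed_F g g' \<open>compact K\<close>] by blast
    \<comment> \<open>Since \<open>g\<close> is monotone, the larger constant and the smaller rate
      dominate both one-sided errors.\<close>
    define C lam where "C = max C1 C2" and "lam = min lam1 lam2"
    have le: "C1 \<le> C" "C2 \<le> C" "lam \<le> lam1" "lam \<le> lam2" by (simp_all add: C_def lam_def)
    have larger: "g (C' * exp (- lam' * t)) \<le> g (C * exp (- lam * t))"
      if "0 < C'" "C' \<le> C" "lam \<le> lam'" "0 \<le> t" for C' lam' t
      using that by (intro mono_onD[OF g(1)] mult_mono) (auto simp: mult_right_mono)
    have "\<bar>u x t - hbar\<bar> \<le> g (C * exp (- lam * t))" if "x \<in> K" "0 \<le> t" for x t
      using 1(3)[OF that] 2(3)[OF that] larger[OF 1(1) le(1,3) that(2)] larger[OF 2(1) le(2,4) that(2)]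
      by linarith
    then have "\<forall>\<^sub>F t in at_top. \<forall>x\<in>K. \<bar>u x t - hbar\<bar> \<le> g (C * exp (- lam * t))"
      by (intro eventually_at_top_linorderI[of 0]) auto
    moreover have "0 < C" "0 < lam" using 1 2 by (auto simp: C_def lam_def)
    ultimately show ?thesis by blast
  qed
  have hoelder_modulus: "modulus (\<lambda>r. L * r powr \<alpha>)" if "0 < \<alpha>" "0 < L" for \<alpha> L :: real
  proof -
    have "continuous_on {0..} (\<lambda>r. L * r powr \<alpha>)"
      using that by (intro continuous_on_mult continuous_on_powr' continuous_on_const continuous_on_id) auto
    moreover have "strict_mono_on {0..} (\<lambda>r. L * r powr \<alpha>)"
      using that by (auto intro!: strict_mono_onI powr_less_mono2)
    ultimately show ?thesis using that by (simp add: modulus_def)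
  qed
  have rate: "L * (C * exp (- lam * t)) powr \<alpha> = L * C powr \<alpha> * exp (- \<alpha> * lam * t)"
    if "0 < C" for L C lam t \<alpha> :: real
    using that by (simp add: powr_mult exp_powr_real mult_ac)
  show ?thesis
  proof (intro conjI allI impI)
    fix g :: "real \<Rightarrow> real" and K :: "(real ^ 'n) set"
    assume "modulus g" "\<forall>x y. \<bar>u0 x - u0 y\<bar> \<le> g (norm (x - y))" "compact K"
    then show "\<exists>C>0. \<exists>lam>0. \<forall>\<^sub>F t in at_top. \<forall>x\<in>K. \<bar>u x t - hbar\<bar> \<le> g (C * exp (- lam * t))"
      by (rule main)
  next
    fix \<alpha> L :: real and K :: "(real ^ 'n) set"
    assume "0 < \<alpha>" "0 < L" "\<forall>x y. \<bar>u0 x - u0 y\<bar> \<le> L * norm (x - y) powr \<alpha>" "compact K"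
    then show "\<exists>lam>0. \<exists>C>0. \<forall>\<^sub>F t in at_top. \<forall>x\<in>K. \<bar>u x t - hbar\<bar> \<le> L * (C * exp (- lam * t)) powr \<alpha>"
      using main[OF hoelder_modulus] by blast
  next
    fix \<alpha> L lam :: real and K :: "(real ^ 'n) set"
    assume "0 < L"
      and "\<exists>C>0. \<forall>\<^sub>F t in at_top. \<forall>x\<in>K. \<bar>u x t - hbar\<bar> \<le> L * (C * exp (- lam * t)) powr \<alpha>"
    then obtain C where "0 < C" "\<forall>\<^sub>F t in at_top. \<forall>x\<in>K. \<bar>u x t - hbar\<bar> \<le> L * (C * exp (- lam * t)) powr \<alpha>"
      by blast
    then have "\<forall>\<^sub>F t in at_top. \<forall>x\<in>K. \<bar>u x t - hbar\<bar> \<le> L * C powr \<alpha> * exp (- \<alpha> * lam * t)"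
      by (simp only: rate)
    moreover have "0 < L * C powr \<alpha>" using \<open>0 < L\<close> \<open>0 < C\<close> by simp
    ultimately show "\<exists>C'>0. \<forall>\<^sub>F t in at_top. \<forall>x\<in>K. \<bar>u x t - hbar\<bar> \<le> C' * exp (- \<alpha> * lam * t)"
      by blast
  qed
qed

end
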